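(* Let $n$ be a positive integer and let $\mathbb{K}$ be a commutative field with $|\mathbb{K}| \geq 2n$. A matrix $A \in M_{n}(\mathbb{K})$ can be written as a product $A = BC$ of two matrices $B, C \in M_n(\mathbb{K})$, each of which is similar over $\mathbb{K}$ to a companion matrix, if and only if $\operatorname{rank}(A) \geq n-2$.
   Context: For a monic polynomial $P(X) = X^n + \sum_{i=0}^{n-1} a_i X^i \in \mathbb{K}[X]$ of degree $n \geq 1$, the companion matrix $C(P) \in M_n(\mathbb{K})$ is the matrix with entries $1$ on the subdiagonal, last column ${}^t(-a_0, -a_1, \ldots, -a_{n-1})$, and all other entries $0$ (for $n=1$, $C(X+a_0) = (-a_0)$). A matrix $M \in M_n(\mathbb{K})$ is similar to a companion matrix if there exist $Q \in GL_n(\mathbb{K})$ and a monic $P \in \mathbb{K}[X]$ of degree $n$ with $M = Q C(P) Q^{-1}$; equivalently, the minimal polynomial of $M$ equals its characteristic polynomial. The field may be infinite; the cardinality condition is then automatically satisfied. The inequality on the rank is between integers (so it is vacuous if $n-2 \le 0$). *)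

theory Defs
  imports
    "Jordan_Normal_Form.DL_Rank"
    "HOL-Computational_Algebra.Polynomial"
begin

text \<open>
  Indices start at 0, so the coefficients appear in the last column
  \<open>degree P - 1\<close> from the constant one at the top downwards. The last-column test takes
  precedence over the subdiagonal test, but the two never conflict, since no row has index
  \<open>degree P\<close>. In degree 1 the matrix is the single entry \<open>- coeff P 0\<close>. The definition
  is meaningful only for monic \<open>P\<close> of degree at least 1.
\<close>

definition companion_mat :: "'a::comm_ring_1 poly \<Rightarrow> 'a mat" where
  "companion_mat P = mat (degree P) (degree P)
     (\<lambda>(i, j). if j = degree P - 1 then - coeff P i
               else if i = j + 1 then 1
               else 0)"

text \<open>
  The condition \<open>degree P = n\<close> for an \<open>n\<close> by \<open>n\<close> matrix \<open>M\<close> needs no separate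
  statement: \<^const>\<open>similar_mat\<close> forces both matrices to be square of the same size.
\<close>

definition similar_to_companion :: "'a::field mat \<Rightarrow> bool" where
  "similar_to_companion M \<longleftrightarrow>
     (\<exists>P. lead_coeff P = 1 \<and> similar_mat M (companion_mat P))"

end

theory Submission
  imports Defs
begin

text \<open>
  Necessity. Changing the last column of a companion matrix gives a cyclic permutation matrix, so a
  matrix that is similar to a companion matrix differs from an invertible matrix by a matrix of rank at
  most one. The product of two such matrices therefore differs from an invertible matrix by two
  matrices of rank at most one, and its rank is at least \<open>n - 2\<close> (\<open>rank_product_of_companions\<close>).

  Sufficiency. A matrix with \<open>n\<close> distinct eigenvalues in the field is similar to a companion matrix, by a
  Vandermonde matrix, so it is enough to find two factors with simple spectrum. A nonzero scalar matrix
  \<open>k\<close> is the product of \<open>diag(k / d i)\<close> and \<open>diag(d i)\<close> for distinct nonzero \<open>d i\<close>. For the nonscalar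
  matrices the idea is that of Sourour's factorization theorem. A nonscalar matrix is similar to
  one with any prescribed corner, say \<open>\<beta> \<gamma>\<close> with nonzero \<open>\<beta>\<close> and \<open>\<gamma>\<close>. If the Schur complement of this
  corner is a product \<open>B C\<close>, then the whole matrix is a product of a lower block triangular matrix with
  diagonal blocks \<open>\<beta>, B\<close> and an upper block triangular matrix with diagonal blocks \<open>\<gamma>, C\<close>
  (\<open>four_block_factorization\<close>). If \<open>\<beta>\<close> is no eigenvalue of \<open>B\<close> and \<open>\<gamma>\<close> none of \<open>C\<close>, both factors
  again have simple spectrum, and induction on the size applies (\<open>factor_simple_spectra\<close>).

  Two points make the induction work. The Schur complement must again be admissible: as long as its
  size is at least two, the corner can be prescribed so that the Schur complement is nonscalar or zero
  (\<open>nonscalar_similar_nonscalar_schur_complement\<close>). And the nullity of the Schur complement is at most that of the matrix, so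
  it stays at most two; this is where the rank enters, since it restricts the zero matrix, which cannot be
  reduced further, to size at most two.

  The number \<open>2 n\<close> of field elements is what the last step consumes: a nonzero number \<open>a\<close> has to be written
  as \<open>\<beta> \<gamma>\<close> where \<open>\<beta>\<close> avoids \<open>n - 1\<close> earlier eigenvalues and \<open>\<gamma> = a / \<beta>\<close> avoids \<open>n - 1\<close> others,
  which excludes \<open>2 (n - 1)\<close> values of \<open>\<beta>\<close> besides zero.
\<close>

section \<open>Scalar matrices, nullity and simple spectra\<close>

definition scalar_mat :: "'a::field mat \<Rightarrow> bool" where
  "scalar_mat A \<longleftrightarrow> (\<exists>k. A = k \<cdot>\<^sub>m 1\<^sub>m (dim_row A))"

text \<open>
  Some \<open>k\<close> linear forms, the rows of \<open>U\<close>, separate the points of the kernel; this says that the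
  kernel has dimension at most \<open>k\<close>. Unlike a rank, this condition can be pulled back along a matrix
  without any dimension count.
\<close>

definition nullity_le :: "nat \<Rightarrow> 'a::field mat \<Rightarrow> bool" where
  "nullity_le k A \<longleftrightarrow> (\<exists>U\<in>carrier_mat k (dim_col A). \<forall>x\<in>carrier_vec (dim_col A).
     A *\<^sub>v x = 0\<^sub>v (dim_row A) \<longrightarrow> U *\<^sub>v x = 0\<^sub>v k \<longrightarrow> x = 0\<^sub>v (dim_col A))"

text \<open>
  Diagonalizable with \<open>n\<close> distinct eigenvalues in the field. The set \<open>F\<close> of forbidden eigenvalues makes
  an induction possible: a block triangular matrix keeps a simple spectrum if the eigenvalue that
  is added is forbidden for the remaining block.
\<close>

definition simple_spectrum :: "nat \<Rightarrow> 'a::field set \<Rightarrow> 'a mat \<Rightarrow> bool" where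
  "simple_spectrum n F B \<longleftrightarrow>
     (\<exists>d. inj_on d {..<n} \<and> d ` {..<n} \<inter> F = {} \<and> similar_mat B (mat_diag n d))"

section \<open>Similarity and block triangular matrices\<close>

lemma similar_mat_conjugate:
  assumes "A \<in> carrier_mat n n" "P \<in> carrier_mat n n" "Q \<in> carrier_mat n n"
    and "P * Q = 1\<^sub>m n" "Q * P = 1\<^sub>m n"
  shows "similar_mat A (Q * A * P)"
proof -
  have "P * (Q * A * P) * Q = (P * Q) * A * (P * Q)"
    using assms(1-3) by (simp add: assoc_mult_mat[of _ n n _ n _ n])
  then show ?thesis
    using assms by (intro similar_matI[of _ _ P Q n]) auto
qed

lemma similar_mat_transpose:
  fixes A :: "'a::field mat"
  assumes "similar_mat A B"
  shows "similar_mat (transpose_mat A) (transpose_mat B)"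
proof -
  obtain n P Q where c: "{A,B,P,Q} \<subseteq> carrier_mat n n"
    and pq: "P * Q = 1\<^sub>m n" "Q * P = 1\<^sub>m n" "A = P * B * Q"
    using similar_matD[OF assms] by blast
  have "transpose_mat (P * B * Q) = transpose_mat Q * transpose_mat B * transpose_mat P"
    using c mult_carrier_mat[of P n n B n] by (simp add: transpose_mult[of "P * B" n n Q n] transpose_mult[of P n n B n]
        assoc_mult_mat[of "transpose_mat Q" n n "transpose_mat B" n "transpose_mat P" n])
  moreover have "transpose_mat Q * transpose_mat P = 1\<^sub>m n" "transpose_mat P * transpose_mat Q = 1\<^sub>m n"
    using c pq by (simp_all add: transpose_mult[of _ n n _ n, symmetric])
  ultimately show ?thesis
    using c pq(3) by (intro similar_matI[of _ _ "transpose_mat Q" "transpose_mat P" n]) auto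
qed

lemma transpose_mat_diag: "transpose_mat (mat_diag n d) = mat_diag n d"
  by (rule eq_matI) (auto simp: mat_diag_def)

lemma simple_spectrum_transpose:
  "simple_spectrum n F B \<Longrightarrow> simple_spectrum n F (transpose_mat B)"
  unfolding simple_spectrum_def by (metis similar_mat_transpose transpose_mat_diag)

lemma simple_spectrum_similar:
  "similar_mat A B \<Longrightarrow> simple_spectrum n F B \<Longrightarrow> simple_spectrum n F A"
  unfolding simple_spectrum_def by (meson similar_mat_trans)

lemma four_block_mat_diag:
  fixes \<beta> :: "'a::field"
  shows "four_block_mat (\<beta> \<cdot>\<^sub>m 1\<^sub>m 1) (0\<^sub>m 1 m) (0\<^sub>m m 1) (mat_diag m d) = mat_diag (Suc m) (case_nat \<beta> d)"
  by (rule eq_matI) (auto simp: mat_diag_def split: nat.splits)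

lemma simple_spectrum_carrier:
  "simple_spectrum n F B \<Longrightarrow> B \<in> carrier_mat n n"
  unfolding simple_spectrum_def using similar_matD by (force simp: mat_diag_def)

text \<open>
  The effect of conjugation by the block matrix with rows \<open>1, u\<close> and \<open>0, 1\<close>. It keeps the lower left
  block \<open>c\<close> while \<open>u\<close> moves the corner and the other blocks; it is used to clear a block, to prescribe a
  corner, and to vary a Schur complement.
\<close>

lemma similar_mat_shear:
  fixes X :: "'a::field mat"
  assumes X: "X \<in> carrier_mat p p" and b: "b \<in> carrier_mat p m" and c: "c \<in> carrier_mat m p"
    and D: "D \<in> carrier_mat m m" and u: "u \<in> carrier_mat p m"
  shows "similar_mat (four_block_mat X b c D)
     (four_block_mat (X - u * c) (b - u * D + (X - u * c) * u) c (D + c * u))"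
proof -
  define P where "P = four_block_mat (1\<^sub>m p) u (0\<^sub>m m p) (1\<^sub>m m)"
  define Q where "Q = four_block_mat (1\<^sub>m p) (- u) (0\<^sub>m m p) (1\<^sub>m m)"
  have i: "four_block_mat (1\<^sub>m p) (0\<^sub>m p m) (0\<^sub>m m p) (1\<^sub>m m) = (1\<^sub>m (p + m) :: 'a mat)"
    by (rule eq_matI) auto
  have "- 0\<^sub>m m m = (0\<^sub>m m m :: 'a mat)"
    by (rule eq_matI) auto
  note i = i this
  have uu: "- u + u = 0\<^sub>m p m" "u + - u = 0\<^sub>m p m"
    using u by (auto intro!: eq_matI)
  have "P * Q = 1\<^sub>m (p + m)" "Q * P = 1\<^sub>m (p + m)"
    unfolding P_def Q_def
    by (subst mult_four_block_mat[of _ p p _ m _ m _ _ p _ m];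
        use u uu i in \<open>simp add: comm_add_mat[of u p m]\<close>)+
  moreover have "Q * four_block_mat X b c D = four_block_mat (X - u * c) (b - u * D) c D"
    unfolding Q_def
    by (subst mult_four_block_mat[of _ p p _ m _ m _ _ p _ m])
      (use X b c D u in \<open>auto simp: add_uminus_minus_mat[of _ p p] add_uminus_minus_mat[of _ p m]\<close>)
  moreover have "four_block_mat (X - u * c) (b - u * D) c D * P
     = four_block_mat (X - u * c) (b - u * D + (X - u * c) * u) c (D + c * u)"
    unfolding P_def
    by (subst mult_four_block_mat[of _ p p _ m _ m _ _ p _ m])
      (use X b c D u in \<open>auto simp: comm_add_mat[of _ p m] comm_add_mat[of _ m m]\<close>)
  ultimately show ?thesis
    using similar_mat_conjugate[of "four_block_mat X b c D" "p + m" P Q] X b c D u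
    by (auto simp: P_def Q_def)
qed

text \<open>
  After \<open>B\<close> is diagonalized to \<open>diag d\<close>, the remaining row is cleared by a shear \<open>u\<close>: the equation
  is \<open>u (diag d - \<beta>) = w'\<close>, and it is solvable because \<open>\<beta>\<close> is none of the values of \<open>d\<close>.
\<close>

lemma simple_spectrum_upper_block:
  fixes \<beta> :: "'a::field"
  assumes B: "simple_spectrum m (insert \<beta> F) B" and w: "w \<in> carrier_mat 1 m" and \<beta>: "\<beta> \<notin> F"
  shows "simple_spectrum (Suc m) F (four_block_mat (\<beta> \<cdot>\<^sub>m 1\<^sub>m 1) w (0\<^sub>m m 1) B)"
proof -
  obtain d where inj: "inj_on d {..<m}" and av: "d ` {..<m} \<inter> insert \<beta> F = {}"
    and sim: "similar_mat B (mat_diag m d)"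
    using B unfolding simple_spectrum_def by blast
  have Bc: "B \<in> carrier_mat m m" using simple_spectrum_carrier[OF B] .
  have \<beta>c: "\<beta> \<cdot>\<^sub>m 1\<^sub>m 1 \<in> carrier_mat 1 1" by simp
  obtain w' where w': "w' \<in> carrier_mat 1 m"
    and s1: "similar_mat (four_block_mat (\<beta> \<cdot>\<^sub>m 1\<^sub>m 1) w (0\<^sub>m m 1) B)
       (four_block_mat (\<beta> \<cdot>\<^sub>m 1\<^sub>m 1) w' (0\<^sub>m m 1) (mat_diag m d))"
    using similar_mat_four_block_0_ex[OF similar_mat_refl[OF \<beta>c] sim w \<beta>c Bc] by blast
  \<comment> \<open>the solution of \<open>u (diag d - \<beta>) = w'\<close>\<close>
  define u where "u = mat 1 m (\<lambda>(i,j). w' $$ (0,j) / (d j - \<beta>))"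
  have u: "u \<in> carrier_mat 1 m" by (simp add: u_def)
  have ne: "d j \<noteq> \<beta>" if "j < m" for j using av that by blast
  have "w' - u * mat_diag m d + (\<beta> \<cdot>\<^sub>m 1\<^sub>m 1 - u * 0\<^sub>m m 1) * u = 0\<^sub>m 1 m"
  proof (rule eq_matI)
    fix i j assume "i < dim_row (0\<^sub>m 1 m :: 'a mat)" "j < dim_col (0\<^sub>m 1 m :: 'a mat)"
    then have ij: "i = 0" "j < m" by auto
    have "w' $$ (0,j) - u $$ (0,j) * d j + \<beta> * u $$ (0,j) = 0"
      using ne[OF ij(2)] ij(2) by (simp add: u_def field_simps)
    moreover have "(\<beta> \<cdot>\<^sub>m 1\<^sub>m 1 - u * 0\<^sub>m m 1) * u = \<beta> \<cdot>\<^sub>m u"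
    proof -
      have "\<beta> \<cdot>\<^sub>m 1\<^sub>m 1 - u * 0\<^sub>m m 1 = \<beta> \<cdot>\<^sub>m 1\<^sub>m 1"
        using u by (auto intro!: eq_matI)
      then show ?thesis using u by (simp add: mult_smult_assoc_mat[of _ 1 1 _ m])
    qed
    ultimately show "(w' - u * mat_diag m d + (\<beta> \<cdot>\<^sub>m 1\<^sub>m 1 - u * 0\<^sub>m m 1) * u) $$ (i, j) = 0\<^sub>m 1 m $$ (i, j)"
      using ij w' u by (simp add: mat_diag_mult_right[of _ 1])
  qed (use w' u in \<open>auto simp: mat_diag_def\<close>)
  moreover have "\<beta> \<cdot>\<^sub>m 1\<^sub>m 1 - u * 0\<^sub>m m 1 = \<beta> \<cdot>\<^sub>m 1\<^sub>m 1" "mat_diag m d + 0\<^sub>m m 1 * u = mat_diag m d"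
    using u by (auto intro!: eq_matI simp: mat_diag_def)
  ultimately have "similar_mat (four_block_mat (\<beta> \<cdot>\<^sub>m 1\<^sub>m 1) w (0\<^sub>m m 1) B) (mat_diag (Suc m) (case_nat \<beta> d))"
    using similar_mat_trans[OF s1 similar_mat_shear[OF \<beta>c w' zero_carrier_mat mat_diag_dim u]]
    by (simp add: four_block_mat_diag flip: One_nat_def)
  moreover have "inj_on (case_nat \<beta> d) {..<Suc m}"
    using inj ne by (auto simp: inj_on_def split: nat.splits)
  moreover have "case_nat \<beta> d ` {..<Suc m} \<inter> F = {}"
    using av \<beta> by (fastforce split: nat.splits)
  ultimately show ?thesis unfolding simple_spectrum_def by blast
qed

lemma simple_spectrum_lower_block:
  fixes \<beta> :: "'a::field"
  assumes B: "simple_spectrum m (insert \<beta> F) B" and w: "w \<in> carrier_mat m 1" and \<beta>: "\<beta> \<notin> F"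
  shows "simple_spectrum (Suc m) F (four_block_mat (\<beta> \<cdot>\<^sub>m 1\<^sub>m 1) (0\<^sub>m 1 m) w B)"
proof -
  have Bc: "B \<in> carrier_mat m m" using simple_spectrum_carrier[OF B] .
  have "transpose_mat (four_block_mat (\<beta> \<cdot>\<^sub>m 1\<^sub>m 1) (transpose_mat w) (0\<^sub>m m 1) (transpose_mat B))
     = four_block_mat (\<beta> \<cdot>\<^sub>m 1\<^sub>m 1) (0\<^sub>m 1 m) w B"
    using w Bc by (auto intro!: eq_matI)
  then show ?thesis
    using simple_spectrum_transpose[OF simple_spectrum_upper_block[OF simple_spectrum_transpose[OF B] _ \<beta>]] w
    by (metis transpose_carrier_mat)
qed

section \<open>Bounding the nullity by linear forms\<close>

lemma vec_nonzero_index: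
  assumes "x \<in> carrier_vec n" "x \<noteq> 0\<^sub>v n" obtains i where "i < n" "x $ i \<noteq> 0"
  using assms by (metis carrier_vecD eq_vecI index_zero_vec)

lemma mat_nonzero_index:
  assumes "A \<in> carrier_mat m n" "A \<noteq> 0\<^sub>m m n" obtains i j where "i < m" "j < n" "A $$ (i,j) \<noteq> 0"
proof -
  have "\<exists>i j. i < m \<and> j < n \<and> A $$ (i,j) \<noteq> 0"
  proof (rule ccontr)
    assume "\<not> ?thesis"
    then have "A = 0\<^sub>m m n" using assms(1) by (intro eq_matI) auto
    then show False using assms(2) by simp
  qed
  then show ?thesis using that by blast
qed

lemma zero_mult_mat_vec:
  fixes x :: "'a::field vec"
  assumes "x \<in> carrier_vec n" shows "0\<^sub>m m n *\<^sub>v x = 0\<^sub>v m"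
  using assms by (intro eq_vecI) auto

lemma mult_mat_zero_vec:
  fixes A :: "'a::field mat"
  assumes "A \<in> carrier_mat m n" shows "A *\<^sub>v 0\<^sub>v n = 0\<^sub>v m"
  using assms by (intro eq_vecI) auto

text \<open>
  The left-invertible matrix \<open>L\<close> embeds the kernel of \<open>A'\<close> into that of \<open>A\<close>, so linear forms that
  separate the latter restrict to forms that separate the former.
\<close>

lemma nullity_le_pullback:
  fixes A :: "'a::field mat"
  assumes "nullity_le k A" and A: "A \<in> carrier_mat r n" and A': "A' \<in> carrier_mat r' m"
    and L: "L \<in> carrier_mat n m" and M: "M \<in> carrier_mat r r'" and K: "K \<in> carrier_mat m n"
    and eq: "A * L = M * A'" and inv: "K * L = 1\<^sub>m m"
  shows "nullity_le k A'"
proof -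
  obtain U where U: "U \<in> carrier_mat k n" and
    inj: "\<And>x. x \<in> carrier_vec n \<Longrightarrow> A *\<^sub>v x = 0\<^sub>v r \<Longrightarrow> U *\<^sub>v x = 0\<^sub>v k \<Longrightarrow> x = 0\<^sub>v n"
    using assms(1) A unfolding nullity_le_def by auto
  have "x = 0\<^sub>v m" if x: "x \<in> carrier_vec m" and 1: "A' *\<^sub>v x = 0\<^sub>v r'" and 2: "(U * L) *\<^sub>v x = 0\<^sub>v k" for x
  proof -
    have "A *\<^sub>v (L *\<^sub>v x) = M *\<^sub>v (A' *\<^sub>v x)"
      using eq by (metis assoc_mult_mat_vec A L M A' x)
    then have "A *\<^sub>v (L *\<^sub>v x) = 0\<^sub>v r" using 1 mult_mat_zero_vec[OF M] by simp
    moreover have "U *\<^sub>v (L *\<^sub>v x) = 0\<^sub>v k" using 2 U L x by (simp add: assoc_mult_mat_vec)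
    ultimately have "L *\<^sub>v x = 0\<^sub>v n" using inj L x by simp
    then have "(K * L) *\<^sub>v x = 0\<^sub>v m"
      using K L x mult_mat_zero_vec[OF K] by (simp add: assoc_mult_mat_vec)
    then show ?thesis using inv x by simp
  qed
  then show ?thesis unfolding nullity_le_def using A' U L by (intro bexI[of _ "U * L"]) auto
qed

lemma nullity_le_similar:
  fixes A :: "'a::field mat"
  assumes "similar_mat A B" "nullity_le k A"
  shows "nullity_le k B"
proof -
  obtain n P Q where c: "{A,B,P,Q} \<subseteq> carrier_mat n n"
    and pq: "P * Q = 1\<^sub>m n" "Q * P = 1\<^sub>m n" "A = P * B * Q"
    using similar_matD[OF assms(1)] by blast
  have "A * P = P * B * (Q * P)"
    using c pq(3) mult_carrier_mat[of P n n B n] by (simp add: assoc_mult_mat[of "P * B" n n Q n P n])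
  moreover have "P * B \<in> carrier_mat n n" using c by auto
  ultimately have "A * P = P * B" using pq(2) by (metis right_mult_one_mat)
  then show ?thesis
    using nullity_le_pullback[OF assms(2), of n n B n n P P Q] c pq by auto
qed

text \<open>
  If \<open>x\<close> is in the kernel of the Schur complement, then \<open>(- b x / a, x)\<close> is in the kernel of the
  whole matrix; \<open>L\<close> is this embedding.
\<close>

lemma nullity_le_schur_complement:
  fixes a :: "'a::field"
  assumes nl: "nullity_le k (four_block_mat (a \<cdot>\<^sub>m 1\<^sub>m 1) b c D)" and a: "a \<noteq> 0"
    and b: "b \<in> carrier_mat 1 m" and c: "c \<in> carrier_mat m 1" and D: "D \<in> carrier_mat m m"
  shows "nullity_le k (D - inverse a \<cdot>\<^sub>m (c * b))"
proof -
  let ?L = "four_block_mat (- inverse a \<cdot>\<^sub>m b) (0\<^sub>m 1 0) (1\<^sub>m m) (0\<^sub>m m 0)"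
  let ?S = "D - inverse a \<cdot>\<^sub>m (c * b)"
  let ?M = "four_block_mat (0\<^sub>m 1 m) (0\<^sub>m 1 0) (1\<^sub>m m) (0\<^sub>m m 0) :: 'a mat"
  \<comment> \<open>Blocks without columns or rows make \<open>L\<close>, \<open>M\<close> and \<open>K\<close> instances of the block product rule:
    \<open>L\<close> stacks \<open>- b / a\<close> on the identity, and \<open>K\<close> forgets the first coordinate.\<close>
  let ?K = "four_block_mat (0\<^sub>m m 1) (1\<^sub>m m) (0\<^sub>m 0 1) (0\<^sub>m 0 m) :: 'a mat"
  have M: "?M * four_block_mat ?S (0\<^sub>m m 0) (0\<^sub>m 0 m) (0\<^sub>m 0 0) = four_block_mat (0\<^sub>m 1 m) (0\<^sub>m 1 0) ?S (0\<^sub>m m 0)"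
    by (subst mult_four_block_mat[of _ 1 m _ 0 _ m _ _ m _ 0]) (use b c D in auto)
  have S: "four_block_mat ?S (0\<^sub>m m 0) (0\<^sub>m 0 m) (0\<^sub>m 0 0) = ?S"
    using b c D by (intro eq_matI) auto
  have e1: "a \<cdot>\<^sub>m 1\<^sub>m 1 * (- inverse a \<cdot>\<^sub>m b) + b * 1\<^sub>m m = 0\<^sub>m 1 m"
    using a b by (simp add: mult_smult_assoc_mat[of _ 1 1 _ m]) (auto intro!: eq_matI)
  have e2: "c * (- inverse a \<cdot>\<^sub>m b) + D * 1\<^sub>m m = ?S"
    using b c D by (simp add: mult_smult_distrib[of c m 1 b m]) (auto intro!: eq_matI)
  have "four_block_mat (a \<cdot>\<^sub>m 1\<^sub>m 1) b c D * ?L = four_block_mat (0\<^sub>m 1 m) (0\<^sub>m 1 0) ?S (0\<^sub>m m 0)"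
    by (subst mult_four_block_mat[of _ 1 1 _ m _ m _ _ m _ 0])
      (use b c D e1 e2 in \<open>auto intro!: cong_four_block_mat eq_matI\<close>)
  then have eq: "four_block_mat (a \<cdot>\<^sub>m 1\<^sub>m 1) b c D * ?L = ?M * ?S"
    using M S by metis
  have "?K * ?L = four_block_mat (1\<^sub>m m) (0\<^sub>m m 0) (0\<^sub>m 0 m) (0\<^sub>m 0 0)"
    by (subst mult_four_block_mat[of _ m 1 _ m _ 0 _ _ m _ 0])
      (use b in \<open>auto intro!: cong_four_block_mat\<close>)
  also have "\<dots> = 1\<^sub>m m" by (intro eq_matI) auto
  finally have inv: "?K * ?L = 1\<^sub>m m" .
  have 1: "four_block_mat (a \<cdot>\<^sub>m 1\<^sub>m 1) b c D \<in> carrier_mat (1 + m) (1 + m)"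
    using D by (intro four_block_carrier_mat) auto
  have 2: "?S \<in> carrier_mat m m" using c b by (intro minus_carrier_mat smult_carrier_mat mult_carrier_mat)
  have 3: "?L \<in> carrier_mat (1 + m) m" "?M \<in> carrier_mat (1 + m) m"
    using four_block_carrier_mat[of "- inverse a \<cdot>\<^sub>m b" 1 m "0\<^sub>m m 0" m 0 "0\<^sub>m 1 0" "1\<^sub>m m"]
      four_block_carrier_mat[of "0\<^sub>m 1 m :: 'a mat" 1 m "0\<^sub>m m 0" m 0 "0\<^sub>m 1 0" "1\<^sub>m m"] b by simp_all
  have 4: "?K \<in> carrier_mat m (1 + m)"
    using four_block_carrier_mat[of "0\<^sub>m m 1 :: 'a mat" m 1 "0\<^sub>m 0 m" 0 m] by simp
  show ?thesis
    by (rule nullity_le_pullback[OF nl 1 2 3 4 eq inv])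
qed

text \<open>
  Otherwise a square matrix made of the \<open>k\<close> forms and a zero row would be singular, and its kernel
  vector would be a nonzero vector that the forms do not detect.
\<close>

lemma nullity_le_zero:
  assumes "nullity_le k (0\<^sub>m n n :: 'a::field mat)"
  shows "n \<le> k"
proof (rule ccontr)
  assume "\<not> n \<le> k"
  obtain U :: "'a mat" where U: "U \<in> carrier_mat k n" and
    inj: "\<And>x. x \<in> carrier_vec n \<Longrightarrow> U *\<^sub>v x = 0\<^sub>v k \<Longrightarrow> x = 0\<^sub>v n"
  proof -
    obtain U :: "'a mat" where "U \<in> carrier_mat k n"
      "\<forall>x\<in>carrier_vec n. 0\<^sub>m n n *\<^sub>v x = 0\<^sub>v n \<longrightarrow> U *\<^sub>v x = 0\<^sub>v k \<longrightarrow> x = 0\<^sub>v n"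
      using assms unfolding nullity_le_def by auto
    then show ?thesis using that zero_mult_mat_vec by blast
  qed
  define V where "V = mat\<^sub>r n n (\<lambda>i. if i = k then 0\<^sub>v n else if i < k then row U i else 0\<^sub>v n)"
  have V: "V \<in> carrier_mat n n" by (simp add: V_def)
  have "det V = 0"
    unfolding V_def by (rule det_row_0) (use U \<open>\<not> n \<le> k\<close> in auto)
  then obtain x where x: "x \<in> carrier_vec n" "x \<noteq> 0\<^sub>v n" "V *\<^sub>v x = 0\<^sub>v n"
    using det_0_iff_vec_prod_zero_field[OF V] by blast
  have "U *\<^sub>v x = 0\<^sub>v k"
  proof (rule eq_vecI)
    fix i assume "i < dim_vec (0\<^sub>v k :: 'a vec)"
    then have i: "i < k" by simp
    have "row U i = row V i" using i U \<open>\<not> n \<le> k\<close> by (simp add: V_def)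
    then have "(U *\<^sub>v x) $ i = (V *\<^sub>v x) $ i" using i U V \<open>\<not> n \<le> k\<close> by simp
    then show "(U *\<^sub>v x) $ i = 0\<^sub>v k $ i" using i x(3) \<open>\<not> n \<le> k\<close> by simp
  qed (use U in auto)
  then show False using inj x by blast
qed

text \<open>
  A maximal independent set of columns, with indices \<open>J\<close>, leaves at most \<open>k\<close> further indices. The
  coordinates at those indices are the separating forms: a kernel vector on which they vanish is a
  linear relation between the columns in \<open>J\<close>.
\<close>

lemma nullity_le_of_rank:
  fixes A :: "'a::field mat"
  assumes A: "A \<in> carrier_mat n m" and r: "m \<le> vec_space.rank n A + k"
  shows "nullity_le k A"
proof -
  interpret vec_space "TYPE('a)" n .
  have cs: "set (cols A) \<subseteq> carrier_vec n" using A cols_dim by blast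
  obtain S where S: "maximal S (\<lambda>T. T \<subseteq> set (cols A) \<and> lin_indpt T)"
    using maximal_exists_superset[of "set (cols A)" "\<lambda>T. T \<subseteq> set (cols A) \<and> lin_indpt T" "{}"]
    by (metis (no_types, lifting) List.finite_set empty_subsetI fin_dim finite_basis_exists subset_li_is_li basis_def)
  have rk: "rank A = card S" using rank_card_indpt[OF A S] .
  have Ss: "S \<subseteq> set (cols A)" and Si: "lin_indpt S" using S unfolding maximal_def by auto
  have fS: "finite S" using Ss by (rule finite_subset) simp
  have "S \<subseteq> col A ` {..<m}"
    using Ss A by (auto simp: cols_def)
  then obtain J where J: "J \<subseteq> {..<m}" and bij: "bij_betw (col A) J S"
    by (metis subset_image_inj bij_betw_def)
  have fJ: "finite J" using J by (rule finite_subset) simp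
  have "card ({..<m} - J) \<le> k"
    using r rk bij_betw_same_card[OF bij] card_Diff_subset[OF fJ J] by simp
  then obtain xs where xs: "set xs = {..<m} - J" "length xs \<le> k"
    by (metis distinct_card finite_Diff finite_distinct_list finite_lessThan)
  define U :: "'a mat" where "U = mat k m (\<lambda>(i,j). if i < length xs \<and> xs ! i = j then 1 else 0)"
  have U: "U \<in> carrier_mat k m" by (simp add: U_def)
  have "x = 0\<^sub>v m" if x: "x \<in> carrier_vec m" and 1: "A *\<^sub>v x = 0\<^sub>v n" and 2: "U *\<^sub>v x = 0\<^sub>v k" for x
  proof -
    have out: "x $ j = 0" if j: "j < m" "j \<notin> J" for j
    proof -
      obtain i where i: "i < length xs" "xs ! i = j" using xs(1) j by (metis DiffI in_set_conv_nth lessThan_iff)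
      have "row U i = unit_vec m j" using i xs(2) by (auto simp: U_def unit_vec_def intro!: eq_vecI)
      then have "(U *\<^sub>v x) $ i = x $ j" using i xs(2) U x j by simp
      then show ?thesis using 2 i xs(2) by simp
    qed
    define g where "g = the_inv_into J (col A)"
    have g: "g (col A j) = j" if "j \<in> J" for j
      using bij that unfolding g_def bij_betw_def by (simp add: the_inv_into_f_f)
    have "lincomb (\<lambda>v. x $ g v) S = 0\<^sub>v n"
    proof (rule eq_vecI)
      fix i assume "i < dim_vec (0\<^sub>v n :: 'a vec)"
      then have i: "i < n" by simp
      have "lincomb (\<lambda>v. x $ g v) S $ i = (\<Sum>v\<in>S. x $ g v * v $ i)"
        using lincomb_index[OF i] Ss cs by blast
      also have "\<dots> = (\<Sum>j\<in>J. x $ g (col A j) * col A j $ i)"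
        using sum.reindex_bij_betw[OF bij, symmetric] .
      also have "\<dots> = (\<Sum>j\<in>J. A $$ (i,j) * x $ j)"
        using g J A i by (intro sum.cong) auto
      also have "\<dots> = (\<Sum>j<m. A $$ (i,j) * x $ j)"
        using J out by (intro sum.mono_neutral_left) auto
      also have "\<dots> = (A *\<^sub>v x) $ i"
        using A x i by (auto simp: scalar_prod_def atLeast0LessThan intro!: sum.cong)
      finally show "lincomb (\<lambda>v. x $ g v) S $ i = 0\<^sub>v n $ i" using 1 by simp
    next
      show "dim_vec (lincomb (\<lambda>v. x $ g v) S) = dim_vec (0\<^sub>v n)"
        using lincomb_dim[OF fS] Ss cs by auto
    qed
    then have "x $ g v = 0" if "v \<in> S" for v
      using lin_dep_crit[OF fS subset_refl _ that, of "\<lambda>v. x $ g v"] Si by auto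
    then have "x $ j = 0" if "j \<in> J" for j
      using g[OF that] bij that unfolding bij_betw_def by (metis image_eqI)
    with out have "x $ j = 0" if "j < m" for j using that by blast
    then show ?thesis using x by (intro eq_vecI) auto
  qed
  then show ?thesis unfolding nullity_le_def using A U by (intro bexI[of _ U]) auto
qed

section \<open>Simple spectra and companion matrices\<close>

lemma invertible_of_trivial_kernel:
  fixes V :: "'a::field mat"
  assumes V: "V \<in> carrier_mat n n" and ker: "\<And>x. x \<in> carrier_vec n \<Longrightarrow> V *\<^sub>v x = 0\<^sub>v n \<Longrightarrow> x = 0\<^sub>v n"
  obtains W where "W \<in> carrier_mat n n" "V * W = 1\<^sub>m n" "W * V = 1\<^sub>m n"
proof -
  have "det V \<noteq> 0" using det_0_iff_vec_prod_zero_field[OF V] ker by blast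
  then show ?thesis
    using det_non_zero_imp_unit[OF V, where b = "()"] that
    unfolding Units_def by (auto simp: ring_mat_simps)
qed

text \<open>
  A kernel vector is the coefficient vector of a polynomial of degree less than \<open>n\<close> that vanishes at \<open>n\<close>
  distinct points.
\<close>

lemma vandermonde_invertible:
  fixes d :: "nat \<Rightarrow> 'a::field"
  assumes "inj_on d {..<n}"
  obtains W where "W \<in> carrier_mat n n" "mat n n (\<lambda>(i,j). d i ^ j) * W = 1\<^sub>m n"
    "W * mat n n (\<lambda>(i,j). d i ^ j) = 1\<^sub>m n"
proof (rule invertible_of_trivial_kernel)
  let ?V = "mat n n (\<lambda>(i,j). d i ^ j)"
  show "?V \<in> carrier_mat n n" by simp
  fix x assume x: "x \<in> carrier_vec n" and eq: "?V *\<^sub>v x = 0\<^sub>v n"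
  define p where "p = (\<Sum>j<n. monom (x $ j) j)"
  have root: "poly p (d i) = 0" if "i < n" for i
  proof -
    have "poly p (d i) = (?V *\<^sub>v x) $ i"
      using that x by (auto simp: p_def poly_sum poly_monom scalar_prod_def atLeast0LessThan mult.commute intro!: sum.cong)
    then show ?thesis using eq that by simp
  qed
  have coeff: "coeff p j = (if j < n then x $ j else 0)" for j
    by (auto simp: p_def coeff_sum)
  have "p = 0"
  proof (rule ccontr)
    assume p: "p \<noteq> 0"
    have "d ` {..<n} \<subseteq> {z. poly p z = 0}" using root by auto
    then have "n \<le> card {z. poly p z = 0}"
      using card_mono[OF poly_roots_finite[OF p]] card_image[OF assms] by (metis card_lessThan)
    also have "\<dots> \<le> degree p" using card_poly_roots_bound[OF p] by simp
    finally have "coeff p (degree p) = 0" using coeff by simp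
    then show False using p by simp
  qed
  then have "x $ j = 0" if "j < n" for j using coeff[of j] that by simp
  then show "x = 0\<^sub>v n" using x by (intro eq_vecI) auto
qed (use that in auto)

text \<open>
  The row \<open>(1, d, ..., d^(n-1))\<close> of a root \<open>d\<close> of \<open>P\<close> is a left eigenvector of the companion matrix
  with eigenvalue \<open>d\<close>; the last column expresses \<open>P(d) = 0\<close>.
\<close>

lemma vandermonde_mult_companion_mat:
  fixes d :: "nat \<Rightarrow> 'a::field"
  assumes lc: "lead_coeff P = 1" and deg: "degree P = n" and root: "\<And>i. i < n \<Longrightarrow> poly P (d i) = 0"
  shows "mat n n (\<lambda>(i,j). d i ^ j) * companion_mat P = mat_diag n d * mat n n (\<lambda>(i,j). d i ^ j)"
proof (rule eq_matI)
  fix i j assume "i < dim_row (mat_diag n d * mat n n (\<lambda>(i,j). d i ^ j))"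
    "j < dim_col (mat_diag n d * mat n n (\<lambda>(i,j). d i ^ j))"
  then have i: "i < n" and j: "j < n" by (auto simp: mat_diag_def)
  have "(mat n n (\<lambda>(i,j). d i ^ j) * companion_mat P) $$ (i,j)
     = (\<Sum>l<n. d i ^ l * (if j = n - 1 then - coeff P l else if l = j + 1 then 1 else 0))"
    using i j deg by (auto simp: companion_mat_def scalar_prod_def atLeast0LessThan intro!: sum.cong)
  also have "\<dots> = d i ^ Suc j"
  proof (cases "j = n - 1")
    case True
    have "0 = (\<Sum>l\<le>n. coeff P l * d i ^ l)" using root[OF i] deg by (simp add: poly_altdef)
    also have "\<dots> = (\<Sum>l<n. coeff P l * d i ^ l) + d i ^ n"
      using lc deg by (simp add: lessThan_Suc_atMost[symmetric])
    finally have "d i ^ n = - (\<Sum>l<n. coeff P l * d i ^ l)" by (simp add: eq_neg_iff_add_eq_0 add.commute)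
    then show ?thesis using True j by (simp add: sum_negf mult.commute)
  next
    case False
    then have "Suc j < n" using j by simp
    then show ?thesis using False by (simp add: if_distrib sum.delta cong: if_cong)
  qed
  also have "\<dots> = (mat_diag n d * mat n n (\<lambda>(i,j). d i ^ j)) $$ (i,j)"
    using i j by (simp add: mat_diag_mult_left[of _ n n])
  finally show "(mat n n (\<lambda>(i,j). d i ^ j) * companion_mat P) $$ (i,j) =
     (mat_diag n d * mat n n (\<lambda>(i,j). d i ^ j)) $$ (i,j)" .
qed (use deg in \<open>auto simp: companion_mat_def mat_diag_def\<close>)

text \<open>
  The Vandermonde matrix of the eigenvalues conjugates the companion matrix of their monic polynomial
  to the diagonal matrix.
\<close>

lemma simple_spectrum_imp_similar_to_companion:
  fixes B :: "'a::field mat"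
  assumes "simple_spectrum n F B"
  shows "similar_to_companion B"
proof -
  obtain d where inj: "inj_on d {..<n}" and sim: "similar_mat B (mat_diag n d)"
    using assms unfolding simple_spectrum_def by blast
  define P where "P = (\<Prod>i<n. [:- d i, 1:])"
  have lc: "lead_coeff P = 1" by (simp add: P_def lead_coeff_prod)
  have deg: "degree P = n" by (simp add: P_def degree_prod_eq_sum_degree)
  have root: "poly P (d i) = 0" if "i < n" for i
    using that by (auto simp: P_def poly_prod)
  let ?V = "mat n n (\<lambda>(i,j). d i ^ j)"
  obtain W where W: "W \<in> carrier_mat n n" "?V * W = 1\<^sub>m n" "W * ?V = 1\<^sub>m n"
    using vandermonde_invertible[OF inj] by blast
  have c: "companion_mat P \<in> carrier_mat n n" using deg by (auto simp: companion_mat_def)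
  have "?V * companion_mat P * W = mat_diag n d * (?V * W)"
    using vandermonde_mult_companion_mat[OF lc deg root]
      assoc_mult_mat[OF mat_diag_dim mat_carrier W(1), of n d "\<lambda>(i,j). d i ^ j"] by simp
  also have "\<dots> = mat_diag n d" using W right_mult_one_mat[OF mat_diag_dim] by simp
  finally have "similar_mat (mat_diag n d) (companion_mat P)"
    using W c by (intro similar_matI[of _ _ ?V W n]) auto
  then show ?thesis
    using lc similar_mat_trans[OF sim] unfolding similar_to_companion_def by blast
qed

section \<open>The rank of a product of two companion matrices\<close>

text \<open>
  Only the last column depends on the polynomial. Changing it to the first unit vector,
  which is a modification of rank at most one, turns the companion matrix into a cyclic permutation
  matrix.
\<close>

lemma companion_mat_near_permutation:
  fixes P :: "'a::field poly"
  assumes n: "n \<ge> 1" and deg: "degree P = n"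
  obtains Z Y f g where "Z \<in> carrier_mat n n" "Y \<in> carrier_mat n n" "Z * Y = 1\<^sub>m n"
    "companion_mat P + mat n n (\<lambda>(i,j). f i * g j) = Z"
proof -
  define f where "f = (\<lambda>i. coeff P i + (if i = 0 then 1 else 0))"
  define g where "g = (\<lambda>j. if j = n - 1 then 1 else 0 :: 'a)"
  define Z where "Z = mat n n (\<lambda>(i,j). if i = (if j = n - 1 then 0 else j + 1) then 1 else 0 :: 'a)"
  have Z: "Z \<in> carrier_mat n n" by (simp add: Z_def)
  \<comment> \<open>\<open>Z\<close> is a permutation matrix, so its transpose is its inverse.\<close>
  have "transpose_mat Z * Z = 1\<^sub>m n"
  proof (rule eq_matI)
    fix i j assume "i < dim_row (1\<^sub>m n :: 'a mat)" "j < dim_col (1\<^sub>m n :: 'a mat)"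
    then have i: "i < n" and j: "j < n" by auto
    have "(transpose_mat Z * Z) $$ (i,j) = (\<Sum>l<n. (if l = (if i = n - 1 then 0 else i + 1) then 1 else 0)
       * (if l = (if j = n - 1 then 0 else j + 1) then 1 else 0))"
      using i j by (auto simp: Z_def scalar_prod_def atLeast0LessThan intro!: sum.cong)
    also have "\<dots> = (if i = j then 1 else 0)"
      using i j by (auto simp: if_distrib[of "\<lambda>x. x * _"] sum.delta cong: if_cong)
    finally show "(transpose_mat Z * Z) $$ (i,j) = 1\<^sub>m n $$ (i,j)" using i j by simp
  qed (auto simp: Z_def)
  then have "Z * transpose_mat Z = 1\<^sub>m n"
    using mat_mult_left_right_inverse[of "transpose_mat Z" n Z] Z by simp
  moreover have "companion_mat P + mat n n (\<lambda>(i,j). f i * g j) = Z"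
    using n deg by (intro eq_matI) (auto simp: companion_mat_def f_def g_def Z_def)
  ultimately show ?thesis using that Z by (metis transpose_carrier_mat)
qed

lemma similar_to_companion_near_invertible:
  fixes B :: "'a::field mat"
  assumes n: "n \<ge> 1" and B: "B \<in> carrier_mat n n" and "similar_to_companion B"
  obtains Z Y f g where "Z \<in> carrier_mat n n" "Y \<in> carrier_mat n n" "Z * Y = 1\<^sub>m n"
    "f \<in> carrier_mat n 1" "g \<in> carrier_mat 1 n" "B + f * g = Z"
proof -
  obtain P where "similar_mat B (companion_mat P)"
    using assms(3) unfolding similar_to_companion_def by blast
  then obtain S T where "similar_mat_wit B (companion_mat P) S T"
    unfolding similar_mat_def by blast
  note w = similar_mat_witD2[OF B this]
  have c: "companion_mat P \<in> carrier_mat n n" "S \<in> carrier_mat n n" "T \<in> carrier_mat n n"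
    and st: "S * T = 1\<^sub>m n" "T * S = 1\<^sub>m n" "B = S * companion_mat P * T"
    using w by auto
  have deg: "degree P = n" using c(1) by (auto simp: companion_mat_def)
  obtain Z Y f g where Z: "Z \<in> carrier_mat n n" "Y \<in> carrier_mat n n" "Z * Y = 1\<^sub>m n"
    and eq: "companion_mat P + mat n n (\<lambda>(i,j). f i * g j) = Z"
    using companion_mat_near_permutation[OF n deg] by blast
  define f' where "f' = mat n 1 (\<lambda>(i,j). f i)"
  define g' where "g' = mat 1 n (\<lambda>(i,j). g j)"
  have f': "f' \<in> carrier_mat n 1" and g': "g' \<in> carrier_mat 1 n" by (auto simp: f'_def g'_def)
  have "mat n n (\<lambda>(i,j). f i * g j) = f' * g'"
    by (intro eq_matI) (auto simp: f'_def g'_def scalar_prod_def)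
  then have eq': "companion_mat P + f' * g' = Z" using eq by simp
  have ST: "S * (companion_mat P + f' * g') * T = S * companion_mat P * T + S * (f' * g') * T"
    using c f' g' mult_add_distrib_mat[of S n n "companion_mat P" n "f' * g'"]
      add_mult_distrib_mat[of "S * companion_mat P" n n "S * (f' * g')" T n] by auto
  have "S * (f' * g') = (S * f') * g'"
    using assoc_mult_mat[OF c(2) f' g'] by simp
  moreover have "(S * f') * g' * T = (S * f') * (g' * T)"
    by (rule assoc_mult_mat[OF mult_carrier_mat[OF c(2) f'] g' c(3)])
  ultimately have "B + (S * f') * (g' * T) = S * Z * T"
    using ST st(3) eq' by simp
  moreover have "(S * Z * T) * (S * Y * T) = 1\<^sub>m n"
  proof -
    have "T * (S * (Y * T)) = Y * T"
      using assoc_mult_mat[OF c(3,2) mult_carrier_mat[OF Z(2) c(3)]] st(2) Z c by simp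
    moreover have "Z * (Y * T) = T"
      using assoc_mult_mat[OF Z(1,2) c(3)] Z(3) c by simp
    ultimately show ?thesis
      using c(2,3) Z(1,2) st(1) by (simp add: assoc_mult_mat[of _ n n _ n _ n])
  qed
  moreover have "S * Z * T \<in> carrier_mat n n" "S * Y * T \<in> carrier_mat n n"
    "S * f' \<in> carrier_mat n 1" "g' * T \<in> carrier_mat 1 n"
    using c Z f' g' by auto
  ultimately show ?thesis using that by blast
qed

text \<open>
  With \<open>B = Z - f g\<close> and \<open>C = Z' - f' g'\<close> for invertible \<open>Z\<close> and \<open>Z'\<close>, the product \<open>B C\<close> differs
  from the invertible \<open>Z Z'\<close> by two matrices of rank at most one.
\<close>

lemma rank_product_of_companions:
  fixes B C :: "'a::field mat"
  assumes n: "n \<ge> 1" and B: "B \<in> carrier_mat n n" and C: "C \<in> carrier_mat n n"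
    and "similar_to_companion B" "similar_to_companion C"
  shows "n \<le> vec_space.rank n (B * C) + 2"
proof -
  interpret vec_space "TYPE('a)" n .
  obtain Z Y f g where Z: "Z \<in> carrier_mat n n" "Y \<in> carrier_mat n n" "Z * Y = 1\<^sub>m n"
    and fg: "f \<in> carrier_mat n 1" "g \<in> carrier_mat 1 n" and eB: "B + f * g = Z"
    using similar_to_companion_near_invertible[OF n B assms(4)] by blast
  obtain Z' Y' f' g' where Z': "Z' \<in> carrier_mat n n" "Y' \<in> carrier_mat n n" "Z' * Y' = 1\<^sub>m n"
    and fg': "f' \<in> carrier_mat n 1" "g' \<in> carrier_mat 1 n" and eC: "C + f' * g' = Z'"
    using similar_to_companion_near_invertible[OF n C assms(5)] by blast
  have r1: "rank (u * v) \<le> 1" if "u \<in> carrier_mat n 1" "v \<in> carrier_mat 1 n" for u v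
    by (rule rank_le_1_product_entries[of _ n "\<lambda>i. u $$ (i,0)" "\<lambda>j. v $$ (0,j)"])
      (use that in \<open>auto simp: scalar_prod_def\<close>)
  have split: "Z * Z' = B * C + f * (g * C) + (Z * f') * g'"
  proof -
    have "Z * Z' = Z * C + Z * (f' * g')"
      using mult_add_distrib_mat[OF Z(1) C, of "f' * g'"] fg' eC by auto
    also have "Z * C = B * C + f * (g * C)"
      using add_mult_distrib_mat[OF B _ C, of "f * g"] assoc_mult_mat[OF fg C] fg eB by auto
    also have "Z * (f' * g') = (Z * f') * g'"
      using assoc_mult_mat[OF Z(1) fg'] by simp
    finally show ?thesis .
  qed
  have "rank (Z * Z') = n"
  proof -
    have "det Z * det Y = 1" "det Z' * det Y' = 1"
      using det_mult[OF Z(1,2)] det_mult[OF Z'(1,2)] Z(3) Z'(3) by auto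
    then have "det (Z * Z') \<noteq> 0" using det_mult[OF Z(1) Z'(1)] by auto
    then show ?thesis using det_rank_iff[of "Z * Z'"] Z Z' by auto
  qed
  then have "rank (B * C + f * (g * C) + (Z * f') * g') = n" by (simp only: split)
  moreover have "rank (B * C + f * (g * C) + (Z * f') * g') \<le> rank (B * C + f * (g * C)) + rank ((Z * f') * g')"
    using Z B C fg fg' by (intro rank_subadditive) auto
  moreover have "rank (B * C + f * (g * C)) \<le> rank (B * C) + rank (f * (g * C))"
    using B C fg by (intro rank_subadditive) auto
  moreover have "rank (f * (g * C)) \<le> 1" "rank ((Z * f') * g') \<le> 1"
    using r1[OF fg(1) mult_carrier_mat[OF fg(2) C]] r1[OF mult_carrier_mat[OF Z(1) fg'(1)] fg'(2)]
    by blast+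
  ultimately show ?thesis by linarith
qed

section \<open>Normal forms of nonscalar matrices\<close>

text \<open>
  If every vector is an eigenvector, the unit vectors show that \<open>A\<close> is diagonal, and the sum of
  two unit vectors shows that the two diagonal entries are equal.
\<close>

lemma nonscalar_has_noneigenvector:
  fixes A :: "'a::field mat"
  assumes A: "A \<in> carrier_mat n n" and ns: "\<not> scalar_mat A"
  obtains x where "x \<in> carrier_vec n" "\<And>k. A *\<^sub>v x \<noteq> k \<cdot>\<^sub>v x"
proof (rule ccontr)
  assume "\<not> thesis"
  then have "\<exists>k. A *\<^sub>v x = k \<cdot>\<^sub>v x" if "x \<in> carrier_vec n" for x
    using that \<open>\<And>x. x \<in> carrier_vec n \<Longrightarrow> (\<And>k. A *\<^sub>v x \<noteq> k \<cdot>\<^sub>v x) \<Longrightarrow> thesis\<close> by blast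
  then obtain \<kappa> where \<kappa>: "A *\<^sub>v x = \<kappa> x \<cdot>\<^sub>v x" if "x \<in> carrier_vec n" for x
    by metis
  define e where "e i = (unit_vec n i :: 'a vec)" for i
  have e: "e i \<in> carrier_vec n" for i by (simp add: e_def)
  have Ae: "A $$ (j,i) = \<kappa> (e i) * (if j = i then 1 else 0)" if "i < n" "j < n" for i j
  proof -
    have "A $$ (j,i) = (A *\<^sub>v e i) $ j" using A that by (simp add: e_def)
    also have "\<dots> = \<kappa> (e i) * e i $ j" using \<kappa>[OF e] that by (simp add: e_def)
    finally show ?thesis using that by (auto simp: e_def)
  qed
  have same: "\<kappa> (e i) = \<kappa> (e j)" if "i < n" "j < n" "i \<noteq> j" for i j
  proof -
    have ij: "e i + e j \<in> carrier_vec n" using e by simp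
    have "A *\<^sub>v (e i + e j) = \<kappa> (e i) \<cdot>\<^sub>v e i + \<kappa> (e j) \<cdot>\<^sub>v e j"
      using \<kappa>[OF e] mult_add_distrib_mat_vec[OF A e e] by simp
    then have eq: "\<kappa> (e i + e j) \<cdot>\<^sub>v (e i + e j) = \<kappa> (e i) \<cdot>\<^sub>v e i + \<kappa> (e j) \<cdot>\<^sub>v e j"
      using \<kappa>[OF ij] by simp
    show ?thesis
      using arg_cong[OF eq, of "\<lambda>v. v $ i"] arg_cong[OF eq, of "\<lambda>v. v $ j"] that
      by (simp add: e_def)
  qed
  have "A = \<kappa> (e 0) \<cdot>\<^sub>m 1\<^sub>m n"
  proof (rule eq_matI)
    fix i j assume "i < dim_row (\<kappa> (e 0) \<cdot>\<^sub>m 1\<^sub>m n)" "j < dim_col (\<kappa> (e 0) \<cdot>\<^sub>m 1\<^sub>m n)"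
    then have "i < n" "j < n" by auto
    then show "A $$ (i,j) = (\<kappa> (e 0) \<cdot>\<^sub>m 1\<^sub>m n) $$ (i,j)"
      using Ae[of j i] same[of 0 j] by (cases "j = 0") auto
  qed (use A in auto)
  then show False using ns A unfolding scalar_mat_def by auto
qed

text \<open>
  The identity matrix with column \<open>k\<close> replaced by \<open>x\<close> is invertible when \<open>x\<close> has a nonzero entry at \<open>k\<close>;
  here the columns \<open>0\<close> and \<open>k\<close> have moreover been exchanged.
\<close>

lemma invertible_with_first_column:
  fixes x :: "'a::field vec"
  assumes x: "x \<in> carrier_vec n" and nz: "x \<noteq> 0\<^sub>v n"
  obtains P Q where "P \<in> carrier_mat n n" "Q \<in> carrier_mat n n" "P * Q = 1\<^sub>m n" "Q * P = 1\<^sub>m n" "col P 0 = x"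
proof -
  obtain k where k: "k < n" "x $ k \<noteq> 0" using vec_nonzero_index[OF x nz] by blast
  define P where "P = mat n n (\<lambda>(i,j). if j = 0 then x $ i else if j = k then (if i = 0 then 1 else 0)
    else if i = j then 1 else 0)"
  have P: "P \<in> carrier_mat n n" by (simp add: P_def)
  have "y = 0\<^sub>v n" if y: "y \<in> carrier_vec n" and ker: "P *\<^sub>v y = 0\<^sub>v n" for y
  proof -
    \<comment> \<open>Besides its entry in column \<open>0\<close>, row \<open>i\<close> of \<open>P\<close> has at most one nonzero entry, a \<open>1\<close> in
      column \<open>\<sigma> i\<close>; the involution \<open>\<sigma>\<close> exchanges \<open>0\<close> and \<open>k\<close>, and for \<open>i = k\<close> there is no such entry.\<close>
    define \<sigma> where "\<sigma> i = (if i = 0 then k else if i = k then 0 else i)" for i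
    have Py: "x $ i * y $ 0 + (if \<sigma> i = 0 then 0 else y $ \<sigma> i) = 0" if i: "i < n" for i
    proof -
      have "(P *\<^sub>v y) $ i = (\<Sum>j<n. P $$ (i,j) * y $ j)"
        using P y i by (auto simp: scalar_prod_def atLeast0LessThan intro!: sum.cong)
      also have "\<dots> = (\<Sum>j<n. (if j = 0 then x $ i * y $ 0 else 0)
          + (if j = \<sigma> i then (if \<sigma> i = 0 then 0 else y $ \<sigma> i) else 0))"
        using i by (intro sum.cong) (auto simp: P_def \<sigma>_def)
      also have "\<dots> = x $ i * y $ 0 + (if \<sigma> i = 0 then 0 else y $ \<sigma> i)"
        using i k by (auto simp: sum.distrib \<sigma>_def)
      finally show ?thesis using ker i by simp
    qed
    have "\<sigma> k = 0" by (simp add: \<sigma>_def)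
    then have y0: "y $ 0 = 0" using Py[OF k(1)] k(2) by simp
    have "y $ j = 0" if j: "j < n" for j
    proof (cases "j = 0")
      case False
      have "\<sigma> (\<sigma> j) = j" "\<sigma> j < n" using j k by (auto simp: \<sigma>_def)
      then show ?thesis using Py[of "\<sigma> j"] y0 False by simp
    qed (use y0 in simp)
    then show ?thesis using y by (intro eq_vecI) auto
  qed
  then obtain Q where "Q \<in> carrier_mat n n" "P * Q = 1\<^sub>m n" "Q * P = 1\<^sub>m n"
    using invertible_of_trivial_kernel[OF P] by blast
  moreover have "col P 0 = x" using x k by (intro eq_vecI) (auto simp: P_def)
  ultimately show ?thesis using that P by blast
qed

text \<open>
  In a basis that starts with a vector \<open>x\<close> that is not an eigenvector, the first column of \<open>A\<close> is not
  a multiple of the first unit vector.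
\<close>

lemma nonscalar_similar_nonzero_column:
  fixes A :: "'a::field mat"
  assumes A: "A \<in> carrier_mat (Suc m) (Suc m)" and ns: "\<not> scalar_mat A"
  obtains X b c D where "X \<in> carrier_mat 1 1" "b \<in> carrier_mat 1 m" "c \<in> carrier_mat m 1" "D \<in> carrier_mat m m"
    "c \<noteq> 0\<^sub>m m 1" "similar_mat A (four_block_mat X b c D)"
proof -
  obtain x where x: "x \<in> carrier_vec (Suc m)" and ne: "\<And>k. A *\<^sub>v x \<noteq> k \<cdot>\<^sub>v x"
    using nonscalar_has_noneigenvector[OF A ns] by blast
  have "x \<noteq> 0\<^sub>v (Suc m)" using ne[of 0] mult_mat_zero_vec[OF A] by auto
  then obtain P Q where P: "P \<in> carrier_mat (Suc m) (Suc m)" and Q: "Q \<in> carrier_mat (Suc m) (Suc m)"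
    and PQ: "P * Q = 1\<^sub>m (Suc m)" and QP: "Q * P = 1\<^sub>m (Suc m)" and col: "col P 0 = x"
    using invertible_with_first_column[OF x] by blast
  define N where "N = Q * A * P"
  have N: "N \<in> carrier_mat (Suc m) (Suc m)" using A P Q by (simp add: N_def)
  obtain X b c D where sp: "split_block N 1 1 = (X, b, c, D)" by (metis prod_cases4)
  have N': "dim_row N = 1 + m" "dim_col N = 1 + m" using N by auto
  note sb = split_block[OF sp N']
  have "c \<noteq> 0\<^sub>m m 1"
  proof
    assume c0: "c = 0\<^sub>m m 1"
    have "A * P = P * N"
    proof -
      have "P * N = P * (Q * (A * P))"
        using assoc_mult_mat[OF Q A P] by (simp add: N_def)
      also have "\<dots> = (P * Q) * (A * P)"
        using assoc_mult_mat[OF P Q mult_carrier_mat[OF A P]] by (rule sym)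
      finally show ?thesis using PQ left_mult_one_mat[OF mult_carrier_mat[OF A P]] by simp
    qed
    then have "A *\<^sub>v x = P *\<^sub>v col N 0"
      using col_mult2[OF A P, of 0] col_mult2[OF P N, of 0] col by simp
    also have "col N 0 = X $$ (0,0) \<cdot>\<^sub>v unit_vec (Suc m) 0"
      using sb c0 by (intro eq_vecI) auto
    also have "P *\<^sub>v (X $$ (0,0) \<cdot>\<^sub>v unit_vec (Suc m) 0) = X $$ (0,0) \<cdot>\<^sub>v x"
    proof -
      have "P *\<^sub>v unit_vec (Suc m) 0 = col P 0"
        using P by (intro eq_vecI) auto
      then show ?thesis
        using mult_mat_vec[OF P unit_vec_carrier] col by simp
    qed
    finally show False using ne by blast
  qed
  moreover have "similar_mat A (four_block_mat X b c D)"
    using similar_mat_conjugate[OF A P Q PQ QP] sb(5) by (simp only: N_def)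
  ultimately show ?thesis using that sb by blast
qed

text \<open>
  A shear by \<open>u\<close> replaces the corner \<open>X\<close> by \<open>X - u c\<close> and keeps \<open>c\<close>. As \<open>c\<close> is not zero, \<open>u c\<close> can
  take any value.
\<close>

lemma nonscalar_similar_prescribed_corner:
  fixes A :: "'a::field mat"
  assumes A: "A \<in> carrier_mat (Suc m) (Suc m)" and ns: "\<not> scalar_mat A"
  obtains b c D where "b \<in> carrier_mat 1 m" "c \<in> carrier_mat m 1" "D \<in> carrier_mat m m"
    "c \<noteq> 0\<^sub>m m 1" "similar_mat A (four_block_mat (a \<cdot>\<^sub>m 1\<^sub>m 1) b c D)"
proof -
  obtain X b c D where bl: "X \<in> carrier_mat 1 1" "b \<in> carrier_mat 1 m" "c \<in> carrier_mat m 1" "D \<in> carrier_mat m m"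
    and c0: "c \<noteq> 0\<^sub>m m 1" and sim: "similar_mat A (four_block_mat X b c D)"
    using nonscalar_similar_nonzero_column[OF A ns] by blast
  obtain i where i: "i < m" "c $$ (i,0) \<noteq> 0" using mat_nonzero_index[OF bl(3) c0] by auto
  define u where "u = mat 1 m (\<lambda>(r,j). if j = i then (X $$ (0,0) - a) / c $$ (i,0) else 0)"
  have u: "u \<in> carrier_mat 1 m" by (simp add: u_def)
  have "(u * c) $$ (0,0) = (\<Sum>j<m. u $$ (0,j) * c $$ (j,0))"
    using u bl(3) by (auto simp: scalar_prod_def atLeast0LessThan intro!: sum.cong)
  also have "\<dots> = (\<Sum>j<m. if j = i then X $$ (0,0) - a else 0)"
    using i by (intro sum.cong) (auto simp: u_def)
  also have "\<dots> = X $$ (0,0) - a" using i by simp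
  finally have "X - u * c = a \<cdot>\<^sub>m 1\<^sub>m 1"
    using u bl by (intro eq_matI) auto
  then have "similar_mat A (four_block_mat (a \<cdot>\<^sub>m 1\<^sub>m 1) (b - u * D + (a \<cdot>\<^sub>m 1\<^sub>m 1) * u) c (D + c * u))"
    using similar_mat_trans[OF sim similar_mat_shear[OF bl u]] by simp
  moreover have "b - u * D + (a \<cdot>\<^sub>m 1\<^sub>m 1) * u \<in> carrier_mat 1 m" "D + c * u \<in> carrier_mat m m"
    using u bl by (auto intro!: add_carrier_mat mult_carrier_mat)
  ultimately show ?thesis using that bl(3) c0 by blast
qed

text \<open>
  The left-hand side has rank one, and a scalar matrix of size at least two has rank zero or full rank.
\<close>

lemma outer_product_not_scalar:
  fixes c :: "'a::field mat"
  assumes c: "c \<in> carrier_mat m 1" "c \<noteq> 0\<^sub>m m 1" and v: "v \<in> carrier_mat 1 m" "v \<noteq> 0\<^sub>m 1 m"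
    and m: "m \<ge> 2"
  shows "c * v \<noteq> k \<cdot>\<^sub>m 1\<^sub>m m"
proof
  assume eq: "c * v = k \<cdot>\<^sub>m 1\<^sub>m m"
  have ent: "c $$ (i,0) * v $$ (0,j) = (if i = j then k else 0)" if "i < m" "j < m" for i j
  proof -
    have "(c * v) $$ (i,j) = c $$ (i,0) * v $$ (0,j)"
      using c v that by (simp add: scalar_prod_def)
    then show ?thesis using eq that by (auto split: if_splits)
  qed
  obtain i where i: "i < m" "c $$ (i,0) \<noteq> 0" using mat_nonzero_index[OF c] by auto
  obtain j where j: "j < m" "v $$ (0,j) \<noteq> 0" using mat_nonzero_index[OF v] by auto
  have "i = j" using ent[OF i(1) j(1)] i j by (auto split: if_splits)
  then have "k \<noteq> 0" using ent[OF i(1) j(1)] i j by auto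
  define l where "l = (if i = 0 then 1 else 0 :: nat)"
  have l: "l < m" "l \<noteq> i" using m by (auto simp: l_def)
  have "v $$ (0,l) \<noteq> 0" using ent[OF l(1) l(1)] \<open>k \<noteq> 0\<close> by auto
  then show False using ent[OF i(1) l(1)] i l by auto
qed

lemma row_orthogonal_to_column:
  fixes c :: "'a::field mat"
  assumes c: "c \<in> carrier_mat m 1" and m: "m \<ge> 2"
  obtains u where "u \<in> carrier_mat 1 m" "u \<noteq> 0\<^sub>m 1 m" "u * c = 0\<^sub>m 1 1"
proof (cases "c $$ (0,0) = 0")
  case True
  define u where "u = mat 1 m (\<lambda>(i,j). if j = 0 then 1 else 0 :: 'a)"
  have "(u * c) $$ (0,0) = (\<Sum>j<m. u $$ (0,j) * c $$ (j,0))"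
    using c by (auto simp: u_def scalar_prod_def atLeast0LessThan intro!: sum.cong)
  also have "\<dots> = 0" using True by (intro sum.neutral) (auto simp: u_def)
  finally have "u * c = 0\<^sub>m 1 1" using c by (intro eq_matI) (auto simp: u_def)
  moreover have "u \<noteq> 0\<^sub>m 1 m"
    using m by (auto simp: u_def dest!: arg_cong[of _ _ "\<lambda>u. u $$ (0,0)"])
  ultimately show ?thesis using that[of u] by (simp add: u_def)
next
  case False
  define u where "u = mat 1 m (\<lambda>(i,j). if j = 0 then c $$ (1,0) else if j = 1 then - c $$ (0,0) else 0)"
  have "(u * c) $$ (0,0) = (\<Sum>j<m. u $$ (0,j) * c $$ (j,0))"
    using c by (auto simp: u_def scalar_prod_def atLeast0LessThan intro!: sum.cong)
  also have "\<dots> = (\<Sum>j<m. (if j = 0 then c $$ (1,0) * c $$ (0,0) else 0) +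
      (if j = 1 then - (c $$ (1,0) * c $$ (0,0)) else 0))"
    by (intro sum.cong) (auto simp: u_def)
  also have "\<dots> = 0" using m by (simp add: sum.distrib)
  finally have "u * c = 0\<^sub>m 1 1" using c by (intro eq_matI) (auto simp: u_def)
  moreover have "u \<noteq> 0\<^sub>m 1 m"
    using m False by (auto simp: u_def dest!: arg_cong[of _ _ "\<lambda>u. u $$ (0,1)"])
  ultimately show ?thesis using that[of u] by (simp add: u_def)
qed

text \<open>
  If the Schur complement \<open>S\<close> is a nonzero scalar matrix \<open>k\<close>, take a shear by a nonzero row \<open>u\<close> with
  \<open>u c = 0\<close>. It keeps the corner and the block \<open>c\<close>. Since \<open>u D = u S + (u c) b / a = k u\<close>, it changes \<open>S\<close> by the
  matrix \<open>(k / a) c u\<close> of rank one, and the sum is not scalar.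

  The alternative \<open>S = 0\<close> cannot be removed: with \<open>m = 2\<close>, a matrix of rank one and corner \<open>a\<close> has
  Schur complement zero.
\<close>

lemma nonscalar_similar_nonscalar_schur_complement:
  fixes A :: "'a::field mat"
  assumes A: "A \<in> carrier_mat (Suc m) (Suc m)" and ns: "\<not> scalar_mat A" and m: "m \<ge> 2" and a: "a \<noteq> 0"
  obtains b c D where "b \<in> carrier_mat 1 m" "c \<in> carrier_mat m 1" "D \<in> carrier_mat m m"
    "similar_mat A (four_block_mat (a \<cdot>\<^sub>m 1\<^sub>m 1) b c D)"
    "\<not> scalar_mat (D - inverse a \<cdot>\<^sub>m (c * b)) \<or> D - inverse a \<cdot>\<^sub>m (c * b) = 0\<^sub>m m m"
proof -
  obtain b c D where b: "b \<in> carrier_mat 1 m" and c: "c \<in> carrier_mat m 1" and D: "D \<in> carrier_mat m m"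
    and c0: "c \<noteq> 0\<^sub>m m 1" and sim: "similar_mat A (four_block_mat (a \<cdot>\<^sub>m 1\<^sub>m 1) b c D)"
    using nonscalar_similar_prescribed_corner[OF A ns] by blast
  define S where "S = D - inverse a \<cdot>\<^sub>m (c * b)"
  have cb: "c * b \<in> carrier_mat m m" using b c by (rule mult_carrier_mat[rotated])
  have S: "S \<in> carrier_mat m m"
    unfolding S_def by (rule minus_carrier_mat[OF smult_carrier_mat[OF cb]])
  have row: "u * S = u * D - inverse a \<cdot>\<^sub>m ((u * c) * b)" if u: "u \<in> carrier_mat 1 m" for u
  proof -
    have "u * S = u * D - u * (inverse a \<cdot>\<^sub>m (c * b))"
      unfolding S_def by (rule mult_minus_distrib_mat[OF u D]) (use cb in simp)
    also have "u * (inverse a \<cdot>\<^sub>m (c * b)) = inverse a \<cdot>\<^sub>m (u * (c * b))"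
      by (rule mult_smult_distrib[OF u cb])
    also have "u * (c * b) = (u * c) * b" by (rule assoc_mult_mat[OF u c b, symmetric])
    finally show ?thesis .
  qed
  show ?thesis
  proof (cases "\<not> scalar_mat S \<or> S = 0\<^sub>m m m")
    case True
    then show ?thesis using that[OF b c D sim] unfolding S_def by blast
  next
    case False
    then obtain k where Sk: "S = k \<cdot>\<^sub>m 1\<^sub>m m" using S unfolding scalar_mat_def by auto
    have k: "k \<noteq> 0" using False Sk by (auto intro!: eq_matI)
    obtain u where u: "u \<in> carrier_mat 1 m" and u0: "u \<noteq> 0\<^sub>m 1 m" and uc: "u * c = 0\<^sub>m 1 1"
      using row_orthogonal_to_column[OF c m] by blast
    have "u * D = k \<cdot>\<^sub>m u"
    proof -
      have "u * S = k \<cdot>\<^sub>m u" using u by (simp add: Sk mult_smult_distrib[OF u one_carrier_mat])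
      moreover have "u * S = u * D"
        using row[OF u] u D b uc by (intro eq_matI) auto
      ultimately show ?thesis by simp
    qed
    define b' where "b' = b - u * D + (a \<cdot>\<^sub>m 1\<^sub>m 1) * u"
    define D' where "D' = D + c * u"
    have uD: "u * D \<in> carrier_mat 1 m" and cu: "c * u \<in> carrier_mat m m"
      using mult_carrier_mat[OF u D] mult_carrier_mat[OF c u] .
    have b'_eq: "b' = b + (a - k) \<cdot>\<^sub>m u"
      unfolding b'_def \<open>u * D = k \<cdot>\<^sub>m u\<close> mult_smult_assoc_mat[OF one_carrier_mat u]
      using b u by (intro eq_matI) (auto simp: algebra_simps)
    have b': "b' \<in> carrier_mat 1 m" and D': "D' \<in> carrier_mat m m"
      using b u D cu by (auto simp: b'_eq D'_def)
    have "similar_mat A (four_block_mat (a \<cdot>\<^sub>m 1\<^sub>m 1) b' c D')"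
    proof -
      have "a \<cdot>\<^sub>m 1\<^sub>m 1 - u * c = a \<cdot>\<^sub>m 1\<^sub>m 1" unfolding uc by (intro eq_matI) auto
      then show ?thesis
        using similar_mat_trans[OF sim similar_mat_shear[OF _ b c D u]] by (simp add: b'_def D'_def)
    qed
    moreover have "\<not> scalar_mat (D' - inverse a \<cdot>\<^sub>m (c * b'))"
    proof
      have "c * b' = c * b + (a - k) \<cdot>\<^sub>m (c * u)"
        unfolding b'_eq using mult_add_distrib_mat[OF c b, of "(a - k) \<cdot>\<^sub>m u"] u
          mult_smult_distrib[OF c u] by simp
      then have S': "D' - inverse a \<cdot>\<^sub>m (c * b') = S + (k / a) \<cdot>\<^sub>m (c * u)"
        using b c u D a unfolding D'_def S_def
        by (intro eq_matI) (auto simp: field_simps simp del: index_mult_mat(1))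
      assume "scalar_mat (D' - inverse a \<cdot>\<^sub>m (c * b'))"
      then obtain l where l: "S + (k / a) \<cdot>\<^sub>m (c * u) = l \<cdot>\<^sub>m 1\<^sub>m m"
        unfolding scalar_mat_def S' using S cu by auto
      have "c * u = ((l - k) * a / k) \<cdot>\<^sub>m 1\<^sub>m m"
      proof (rule eq_matI)
        fix i j assume "i < dim_row (((l - k) * a / k) \<cdot>\<^sub>m 1\<^sub>m m)" "j < dim_col (((l - k) * a / k) \<cdot>\<^sub>m 1\<^sub>m m)"
        then have ij: "i < m" "j < m" by auto
        have "(S + (k / a) \<cdot>\<^sub>m (c * u)) $$ (i,j) = S $$ (i,j) + k / a * (c * u) $$ (i,j)"
          using S c u ij by (simp del: index_mult_mat(1))
        then have "(if i = j then l else 0) = (if i = j then k else 0) + k / a * (c * u) $$ (i,j)"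
          unfolding l using ij Sk by (auto split: if_splits)
        then show "(c * u) $$ (i,j) = (((l - k) * a / k) \<cdot>\<^sub>m 1\<^sub>m m) $$ (i,j)"
          using ij k a by (auto simp: field_simps simp del: index_mult_mat(1) split: if_splits)
      qed (use cu in auto)
      then show False using outer_product_not_scalar[OF c c0 u u0 m] by blast
    qed
    ultimately show ?thesis using that b' c D' by blast
  qed
qed

section \<open>Factorization into matrices with simple spectra\<close>

text \<open>
  A factorization of the Schur complement extends to a factorization of the whole matrix into a lower
  and an upper block triangular factor, whose corners are any two nonzero numbers with
  product equal to the given corner.
\<close>

lemma four_block_factorization:
  fixes \<beta> \<gamma> :: "'a::field"
  assumes nz: "\<beta> \<noteq> 0" "\<gamma> \<noteq> 0"
    and b: "b \<in> carrier_mat 1 m" and c: "c \<in> carrier_mat m 1" and D: "D \<in> carrier_mat m m"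
    and B: "B \<in> carrier_mat m m" and C: "C \<in> carrier_mat m m"
    and eq: "D - inverse (\<beta> * \<gamma>) \<cdot>\<^sub>m (c * b) = B * C"
  shows "four_block_mat ((\<beta> * \<gamma>) \<cdot>\<^sub>m 1\<^sub>m 1) b c D
     = four_block_mat (\<beta> \<cdot>\<^sub>m 1\<^sub>m 1) (0\<^sub>m 1 m) (inverse \<gamma> \<cdot>\<^sub>m c) B
     * four_block_mat (\<gamma> \<cdot>\<^sub>m 1\<^sub>m 1) (inverse \<beta> \<cdot>\<^sub>m b) (0\<^sub>m m 1) C"
proof -
  have cb: "c * b \<in> carrier_mat m m" using mult_carrier_mat[OF c b] .
  have 1: "(\<beta> \<cdot>\<^sub>m 1\<^sub>m 1) * (\<gamma> \<cdot>\<^sub>m 1\<^sub>m 1) + 0\<^sub>m 1 m * 0\<^sub>m m 1 = (\<beta> * \<gamma>) \<cdot>\<^sub>m (1\<^sub>m 1 :: 'a mat)"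
    by (intro eq_matI) (auto simp: scalar_prod_def)
  have 2: "(\<beta> \<cdot>\<^sub>m 1\<^sub>m 1) * (inverse \<beta> \<cdot>\<^sub>m b) + 0\<^sub>m 1 m * C = b"
  proof -
    have "(\<beta> \<cdot>\<^sub>m 1\<^sub>m 1) * (inverse \<beta> \<cdot>\<^sub>m b) = \<beta> \<cdot>\<^sub>m (inverse \<beta> \<cdot>\<^sub>m b)"
      using mult_smult_assoc_mat[of "1\<^sub>m 1" 1 1 "inverse \<beta> \<cdot>\<^sub>m b" m \<beta>] b by simp
    also have "\<dots> = b" using nz by (intro eq_matI) auto
    finally show ?thesis using b left_mult_zero_mat[OF C, of 1] by simp
  qed
  have 3: "(inverse \<gamma> \<cdot>\<^sub>m c) * (\<gamma> \<cdot>\<^sub>m 1\<^sub>m 1) + B * 0\<^sub>m m 1 = c"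
  proof -
    have "(inverse \<gamma> \<cdot>\<^sub>m c) * (\<gamma> \<cdot>\<^sub>m 1\<^sub>m 1) = \<gamma> \<cdot>\<^sub>m (inverse \<gamma> \<cdot>\<^sub>m c)"
      using mult_smult_distrib[of "inverse \<gamma> \<cdot>\<^sub>m c" m 1 "1\<^sub>m 1" 1 \<gamma>] c by simp
    also have "\<dots> = c" using nz by (intro eq_matI) auto
    finally show ?thesis using c right_mult_zero_mat[OF B, of 1] by simp
  qed
  have 4: "(inverse \<gamma> \<cdot>\<^sub>m c) * (inverse \<beta> \<cdot>\<^sub>m b) + B * C = D"
  proof -
    have "(inverse \<gamma> \<cdot>\<^sub>m c) * (inverse \<beta> \<cdot>\<^sub>m b) = inverse \<gamma> \<cdot>\<^sub>m (inverse \<beta> \<cdot>\<^sub>m (c * b))"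
      using mult_smult_assoc_mat[of c m 1 "inverse \<beta> \<cdot>\<^sub>m b" m] mult_smult_distrib[OF c b] b c by simp
    also have "\<dots> = inverse (\<beta> * \<gamma>) \<cdot>\<^sub>m (c * b)"
      using cb by (intro eq_matI) (auto simp del: index_mult_mat(1) simp: mult.commute)
    finally show ?thesis
      unfolding eq[symmetric] using b c D
      by (intro eq_matI) (auto simp del: index_mult_mat(1))
  qed
  show ?thesis
    by (subst mult_four_block_mat[of _ 1 1 _ m _ m _ _ 1 _ m]) (use b c B C 1 2 3 4 in auto)
qed

lemma conjugate_mult:
  fixes B :: "'a::field mat"
  assumes B: "B \<in> carrier_mat n n" and C: "C \<in> carrier_mat n n"
    and P: "P \<in> carrier_mat n n" and Q: "Q \<in> carrier_mat n n" and QP: "Q * P = 1\<^sub>m n"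
  shows "(P * B * Q) * (P * C * Q) = P * (B * C) * Q"
proof -
  have CQ: "C * Q \<in> carrier_mat n n" using C Q by simp
  have "Q * (P * (C * Q)) = C * Q"
    using assoc_mult_mat[OF Q P CQ] left_mult_one_mat[OF CQ] by (simp only: QP)
  then show ?thesis
    using B C P Q by (simp add: assoc_mult_mat[of _ n n _ n _ n])
qed

lemma exists_fresh:
  assumes "finite S" "infinite (UNIV :: 'a set) \<or> card S < card (UNIV :: 'a set)"
  obtains x :: 'a where "x \<notin> S"
  using assms by (metis UNIV_eq_I nat_neq_iff)

lemma simple_spectrum_1:
  "\<beta> \<notin> F \<Longrightarrow> simple_spectrum 1 F (\<beta> \<cdot>\<^sub>m 1\<^sub>m 1 :: 'a::field mat)"
proof -
  assume "\<beta> \<notin> F"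
  have "\<beta> \<cdot>\<^sub>m 1\<^sub>m 1 = mat_diag 1 (\<lambda>_. \<beta>)"
    by (intro eq_matI) (auto simp: mat_diag_def)
  then have "similar_mat (\<beta> \<cdot>\<^sub>m 1\<^sub>m 1) (mat_diag 1 (\<lambda>_. \<beta>))"
    using similar_mat_refl[OF mat_diag_dim] by metis
  then show ?thesis
    using \<open>\<beta> \<notin> F\<close> unfolding simple_spectrum_def by (intro exI[of _ "\<lambda>_. \<beta>"]) (auto simp: inj_on_def)
qed

text \<open>
  Induction on the size, with \<open>F\<close> and \<open>G\<close> collecting the eigenvalues that are already used. A
  nonscalar \<open>A\<close> is brought to a form whose corner is a product \<open>\<beta> \<gamma>\<close> of two fresh nonzero numbers;
  its Schur complement is factored by the induction hypothesis, and \<open>\<beta>\<close> and \<open>\<gamma>\<close> become the new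
  eigenvalues of the two factors.

  The assumption on the nullity passes to the Schur complement. It is needed when
  \<open>A = 0\<close>: the nullity then bounds the size by two, and the zero matrix of size two is the product of
  \<open>diag(0, \<beta>)\<close> and \<open>diag(\<gamma>, 0)\<close>.

  The bound on the cardinality of the field is the one required in size one, where
  an entry \<open>a \<noteq> 0\<close> is written as \<open>\<beta> \<gamma>\<close>: here \<open>\<beta>\<close> avoids \<open>0\<close>, the elements of \<open>F\<close> and the quotients
  of \<open>a\<close> by elements of \<open>G\<close>. Each step to a larger size uses one element less of \<open>F\<close> and of \<open>G\<close>, so the
  bound remains the same.
\<close>

lemma factor_simple_spectra:
  fixes A :: "'a::field mat"
  assumes "A \<in> carrier_mat n n" "n \<ge> 1" "n = 1 \<or> \<not> scalar_mat A \<or> A = 0\<^sub>m n n" "nullity_le 2 A"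
    and "finite F" "finite G" "0 \<notin> F" "0 \<notin> G"
    and "infinite (UNIV :: 'a set) \<or> 2 * n + card F + card G \<le> card (UNIV :: 'a set)"
  obtains B C where "simple_spectrum n F B" "simple_spectrum n G C" "A = B * C"
  using assms
proof (induction n arbitrary: A F G thesis)
  case 0
  then show ?case by simp
next
  case (Suc m)
  note finF = \<open>finite F\<close> and finG = \<open>finite G\<close>
  have A: "A \<in> carrier_mat (Suc m) (Suc m)" by fact
  have avoid: "\<exists>x. x \<notin> T" if "finite T" "card T < 2 * Suc m + card F + card G" for T :: "'a set"
    using exists_fresh[of T] that Suc.prems(10) by (metis order_less_le_trans)
  consider "m = 0" | "m \<ge> 1" "A = 0\<^sub>m (Suc m) (Suc m)" | "m \<ge> 1" "\<not> scalar_mat A"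
    using Suc.prems(4) by fastforce
  then show ?case
  proof cases
    case 1
    define a where "a = A $$ (0,0)"
    have Aa: "A = a \<cdot>\<^sub>m 1\<^sub>m 1" using A 1 by (intro eq_matI) (auto simp: a_def)
    have "\<exists>\<beta> \<gamma>. \<beta> \<notin> F \<and> \<gamma> \<notin> G \<and> a = \<beta> * \<gamma>"
    proof (cases "a = 0")
      case True
      obtain \<gamma> where "\<gamma> \<notin> G" using avoid[OF finG] by auto
      then show ?thesis using True \<open>0 \<notin> F\<close> by (metis mult_zero_left)
    next
      case False
      let ?T = "insert 0 (F \<union> (\<lambda>\<gamma>. a / \<gamma>) ` G)"
      have "card ?T \<le> Suc (card (F \<union> (\<lambda>\<gamma>. a / \<gamma>) ` G))" by (rule card_insert_le_m1) auto
      also have "\<dots> \<le> Suc (card F + card G)"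
        using card_Un_le[of F "(\<lambda>\<gamma>. a / \<gamma>) ` G"] card_image_le[OF finG, of "\<lambda>\<gamma>. a / \<gamma>"] by linarith
      finally obtain \<beta> where \<beta>: "\<beta> \<notin> ?T" using avoid[of ?T] finF finG by auto
      then have "a / \<beta> \<notin> G" using False by (auto simp: image_iff)
      then show ?thesis using \<beta> by (intro exI[of _ \<beta>] exI[of _ "a / \<beta>"]) auto
    qed
    then obtain \<beta> \<gamma> where bg: "\<beta> \<notin> F" "\<gamma> \<notin> G" "a = \<beta> * \<gamma>" by blast
    have "A = (\<beta> \<cdot>\<^sub>m 1\<^sub>m 1) * (\<gamma> \<cdot>\<^sub>m 1\<^sub>m 1)"
      unfolding Aa bg(3) by (intro eq_matI) (auto simp: scalar_prod_def)
    then show ?thesis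
      using Suc.prems(1) simple_spectrum_1[OF bg(1)] simple_spectrum_1[OF bg(2)] 1 by auto
  next
    case 2
    have "m = 1" using nullity_le_zero[of 2 "Suc m"] Suc.prems(5) 2 by simp
    obtain \<beta> where \<beta>: "\<beta> \<notin> insert 0 F"
      using avoid[of "insert 0 F"] finF card_insert_le_m1[of "Suc (card F)" F 0] by auto
    obtain \<gamma> where \<gamma>: "\<gamma> \<notin> insert 0 G"
      using avoid[of "insert 0 G"] finG card_insert_le_m1[of "Suc (card G)" G 0] by auto
    let ?B = "four_block_mat (0 \<cdot>\<^sub>m 1\<^sub>m 1) (0\<^sub>m 1 1) (0\<^sub>m 1 1) (\<beta> \<cdot>\<^sub>m 1\<^sub>m 1)"
    let ?C = "four_block_mat (\<gamma> \<cdot>\<^sub>m 1\<^sub>m 1) (0\<^sub>m 1 1) (0\<^sub>m 1 1) (0 \<cdot>\<^sub>m 1\<^sub>m 1)"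
    have "simple_spectrum (Suc 1) F ?B"
      using \<beta> \<open>0 \<notin> F\<close> by (intro simple_spectrum_upper_block simple_spectrum_1) auto
    moreover have "simple_spectrum (Suc 1) G ?C"
      using \<gamma> \<open>0 \<notin> G\<close> by (intro simple_spectrum_upper_block simple_spectrum_1) auto
    moreover have "?B * ?C = 0\<^sub>m 2 2"
      by (subst mult_four_block_mat[of _ 1 1 _ 1 _ 1 _ _ 1 _ 1]) (auto intro!: eq_matI simp: scalar_prod_def)
    ultimately show ?thesis using Suc.prems(1)[of ?B ?C] 2 \<open>m = 1\<close> by (simp add: numeral_2_eq_2)
  next
    case 3
    obtain \<beta> where \<beta>: "\<beta> \<notin> insert 0 F"
      using avoid[of "insert 0 F"] finF card_insert_le_m1[of "Suc (card F)" F 0] by auto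
    obtain \<gamma> where \<gamma>: "\<gamma> \<notin> insert 0 G"
      using avoid[of "insert 0 G"] finG card_insert_le_m1[of "Suc (card G)" G 0] by auto
    have a0: "\<beta> * \<gamma> \<noteq> 0" using \<beta> \<gamma> by auto
    obtain b c D where b: "b \<in> carrier_mat 1 m" and c: "c \<in> carrier_mat m 1" and D: "D \<in> carrier_mat m m"
      and sim: "similar_mat A (four_block_mat ((\<beta> * \<gamma>) \<cdot>\<^sub>m 1\<^sub>m 1) b c D)"
      and S: "m = 1 \<or> \<not> scalar_mat (D - inverse (\<beta> * \<gamma>) \<cdot>\<^sub>m (c * b)) \<or> D - inverse (\<beta> * \<gamma>) \<cdot>\<^sub>m (c * b) = 0\<^sub>m m m"
    proof (cases "m = 1")
      case True
      then show ?thesis using nonscalar_similar_prescribed_corner[OF A 3(2)] that by blast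
    next
      case False
      then have "m \<ge> 2" using 3(1) by simp
      then show ?thesis using nonscalar_similar_nonscalar_schur_complement[OF A 3(2) _ a0] that by blast
    qed
    let ?S = "D - inverse (\<beta> * \<gamma>) \<cdot>\<^sub>m (c * b)"
    have Sc: "?S \<in> carrier_mat m m"
      by (rule minus_carrier_mat[OF smult_carrier_mat[OF mult_carrier_mat[OF c b]]])
    have nS: "nullity_le 2 ?S"
      using nullity_le_schur_complement[OF nullity_le_similar[OF sim Suc.prems(5)] a0 b c D] .
    have bound: "infinite (UNIV :: 'a set) \<or> 2 * m + card (insert \<beta> F) + card (insert \<gamma> G) \<le> card (UNIV :: 'a set)"
      using Suc.prems(10) \<beta> \<gamma> finF finG by auto
    obtain B C where B: "simple_spectrum m (insert \<beta> F) B" and C: "simple_spectrum m (insert \<gamma> G) C"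
      and eq: "?S = B * C"
      using Suc.IH[OF _ Sc 3(1) S nS _ _ _ _ bound] finF finG \<beta> \<gamma> Suc.prems(8,9) by auto
    let ?B = "four_block_mat (\<beta> \<cdot>\<^sub>m 1\<^sub>m 1) (0\<^sub>m 1 m) (inverse \<gamma> \<cdot>\<^sub>m c) B"
    let ?C = "four_block_mat (\<gamma> \<cdot>\<^sub>m 1\<^sub>m 1) (inverse \<beta> \<cdot>\<^sub>m b) (0\<^sub>m m 1) C"
    have fac: "four_block_mat ((\<beta> * \<gamma>) \<cdot>\<^sub>m 1\<^sub>m 1) b c D = ?B * ?C"
      using four_block_factorization[OF _ _ b c D simple_spectrum_carrier[OF B] simple_spectrum_carrier[OF C] eq]
        \<beta> \<gamma> by simp
    have sB: "simple_spectrum (Suc m) F ?B"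
      using simple_spectrum_lower_block[OF B] c \<beta> by simp
    have sC: "simple_spectrum (Suc m) G ?C"
      using simple_spectrum_upper_block[OF C] b \<gamma> by simp
    have Bc: "?B \<in> carrier_mat (Suc m) (Suc m)" and Cc: "?C \<in> carrier_mat (Suc m) (Suc m)"
      using simple_spectrum_carrier sB sC by blast+
    obtain P Q where wit: "similar_mat_wit A (?B * ?C) P Q"
      using sim unfolding fac similar_mat_def by blast
    note w = similar_mat_witD2[OF A wit]
    have "similar_mat (P * ?B * Q) ?B" "similar_mat (P * ?C * Q) ?C"
      using w Bc Cc by (auto intro!: similar_matI[of _ _ P Q "Suc m"])
    then have "simple_spectrum (Suc m) F (P * ?B * Q)" "simple_spectrum (Suc m) G (P * ?C * Q)"
      using simple_spectrum_similar sB sC by blast+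
    moreover have "A = (P * ?B * Q) * (P * ?C * Q)"
      unfolding w(3) by (rule conjugate_mult[symmetric]) (fact Bc Cc w)+
    ultimately show ?thesis using Suc.prems(1) by blast
  qed
qed

lemma mat_diag_simple_spectrum:
  "inj_on d {..<n} \<Longrightarrow> simple_spectrum n {} (mat_diag n d :: 'a::field mat)"
  unfolding simple_spectrum_def using similar_mat_refl[OF mat_diag_dim] by blast

text \<open>
  For any distinct nonzero \<open>d i\<close>, the numbers \<open>k / d i\<close> are distinct as well.
\<close>

lemma scalar_factor_simple_spectra:
  fixes k :: "'a::field"
  assumes k: "k \<noteq> 0" and card: "infinite (UNIV :: 'a set) \<or> n < card (UNIV :: 'a set)"
  obtains B C where "simple_spectrum n {} B" "simple_spectrum n {} C" "k \<cdot>\<^sub>m 1\<^sub>m n = B * C"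
proof -
  have "\<exists>T. T \<subseteq> UNIV - {0 :: 'a} \<and> finite T \<and> card T = n"
  proof (cases "finite (UNIV :: 'a set)")
    case True
    then have "n \<le> card (UNIV - {0 :: 'a})" using card by simp
    then show ?thesis by (metis obtain_subset_with_card_n)
  next
    case False
    then have "infinite (UNIV - {0 :: 'a})" by simp
    then show ?thesis using infinite_arbitrarily_large by metis
  qed
  then obtain T :: "'a set" where T: "T \<subseteq> UNIV - {0}" "finite T" "card T = n" by blast
  obtain d where d: "bij_betw d {..<n} T"
    using ex_bij_betw_nat_finite[OF T(2)] T(3) by (metis atLeast0LessThan)
  have inj: "inj_on d {..<n}" using d by (rule bij_betw_imp_inj_on)
  have d0: "d i \<noteq> 0" if "i < n" for i
    using d T(1) that by (auto simp: bij_betw_def)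
  have inj': "inj_on (\<lambda>i. k / d i) {..<n}"
    using inj d0 k by (auto simp: inj_on_def divide_simps)
  have "k \<cdot>\<^sub>m 1\<^sub>m n = mat_diag n (\<lambda>i. k / d i) * mat_diag n d"
    unfolding mat_diag_diag using d0 by (intro eq_matI) (auto simp: mat_diag_def)
  then show ?thesis
    by (rule that[OF mat_diag_simple_spectrum[OF inj'] mat_diag_simple_spectrum[OF inj]])
qed

theorem theorem1p1:
  fixes A :: "'a::field mat" and n :: nat
  assumes "n \<ge> 1"
    and "infinite (UNIV :: 'a set) \<or> card (UNIV :: 'a set) \<ge> 2 * n"
    and "A \<in> carrier_mat n n"
  shows "(\<exists>B C. B \<in> carrier_mat n n \<and> C \<in> carrier_mat n n
            \<and> similar_to_companion B \<and> similar_to_companion C \<and> A = B * C)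
         \<longleftrightarrow> int (vec_space.rank n A) \<ge> int n - 2"
proof
  assume "\<exists>B C. B \<in> carrier_mat n n \<and> C \<in> carrier_mat n n
            \<and> similar_to_companion B \<and> similar_to_companion C \<and> A = B * C"
  then have "n \<le> vec_space.rank n A + 2"
    using rank_product_of_companions[OF assms(1)] by blast
  then show "int (vec_space.rank n A) \<ge> int n - 2" by linarith
next
  assume "int (vec_space.rank n A) \<ge> int n - 2"
  then have nullity: "nullity_le 2 A"
    by (intro nullity_le_of_rank[OF assms(3)]) linarith
  obtain B C where "simple_spectrum n {} B" "simple_spectrum n {} C" "A = B * C"
  proof (cases "scalar_mat A \<and> A \<noteq> 0\<^sub>m n n")
    case True
    then obtain k where k: "A = k \<cdot>\<^sub>m 1\<^sub>m n" "A \<noteq> 0\<^sub>m n n"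
      using assms(3) unfolding scalar_mat_def by auto
    have "k \<noteq> 0" using k by (auto intro!: eq_matI)
    moreover have "infinite (UNIV :: 'a set) \<or> n < card (UNIV :: 'a set)"
      using assms(1,2) by auto
    ultimately show ?thesis
      using scalar_factor_simple_spectra that k(1) by metis
  next
    case False
    then show ?thesis
      using factor_simple_spectra[OF assms(3,1) _ nullity, of "{}" "{}"] assms(2) that by auto
  qed
  then show "\<exists>B C. B \<in> carrier_mat n n \<and> C \<in> carrier_mat n n
            \<and> similar_to_companion B \<and> similar_to_companion C \<and> A = B * C"
    using simple_spectrum_carrier simple_spectrum_imp_similar_to_companion by blast
qed

end
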